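(* Let $n\ge 1$. (1) A set $S\subseteq\mathbb{Z}^n$ is a box of integers if and only if it is both multimodular and L$_2^\natural$-convex. (2) A function $f:\mathbb{Z}^n\to\mathbb{R}\cup\{+\infty\}$ is separable convex if and only if it is both multimodular and L$_2^\natural$-convex.
   Context: Notation: $\mathbf{1}=(1,\dots,1)$; $x\vee y$, $x\wedge y$ are componentwise max/min; $\lceil\cdot\rceil,\lfloor\cdot\rfloor$ act componentwise. For $f:\mathbb{Z}^n\to\mathbb{R}\cup\{+\infty\}$, $\operatorname{dom} f=\{x: f(x)<+\infty\}$, always assumed nonempty. The indicator $\delta_S$ of $S$ is $0$ on $S$ and $+\infty$ off $S$. A function $h$ on $\mathbb{Z}^m$ is submodular if $h(u)+h(v)\ge h(u\vee v)+h(u\wedge v)$ for all $u,v$. A box of integers is a set $[a,b]_{\mathbb{Z}}=\{x\in\mathbb{Z}^n: a_i\le x_i\le b_i\ \forall i\}$ with $a\in(\mathbb{Z}\cup\{-\infty\})^n$, $b\in(\mathbb{Z}\cup\{+\infty\})^n$, $a\le b$. A function $f$ is separable convex if $f(x)=\sum_{i=1}^n\varphi_i(x_i)$ with univariate $\varphi_i:\mathbb{Z}\to\mathbb{R}\cup\{+\infty\}$ whose effective domains are (nonempty) intervals of integers and which satisfy $\varphi_i(t-1)+\varphi_i(t+1)\ge 2\varphi_i(t)$ for all $t\in\mathbb{Z}$. A function $f$ is multimodular if the function $\tilde f(x_0,x)=f(x_1-x_0,x_2-x_1,\dots,x_n-x_{n-1})$ on $\mathbb{Z}^{n+1}$ is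 submodular. A nonempty set $S$ is multimodular if $\delta_S$ is multimodular. A function $f$ is L$^\natural$-convex if $f(x)+f(y)\ge f(\lceil (x+y)/2\rceil)+f(\lfloor (x+y)/2\rfloor)$ for all $x,y\in\mathbb{Z}^n$. A nonempty set $S$ is L$^\natural$-convex if $x,y\in S$ implies $\lceil (x+y)/2\rceil,\lfloor (x+y)/2\rfloor\in S$ (equivalently $\delta_S$ is L$^\natural$-convex). A nonempty set is L$_2^\natural$-convex if it is the Minkowski sum $S_1+S_2=\{y+z: y\in S_1, z\in S_2\}$ of two L$^\natural$-convex sets. A function $f$ is L$_2^\natural$-convex if $f=f_1\Box f_2$, i.e. $f(x)=\inf\{f_1(y)+f_2(z): y+z=x,\ y,z\in\mathbb{Z}^n\}$, for two L$^\natural$-convex functions $f_1,f_2$. *)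

theory Defs
  imports "HOL-Library.Extended" "HOL-Library.Extended_Real" "Jordan_Normal_Form.Matrix"
begin

no_notation Pinf ("\<infinity>") and Minf ("-\<infinity>")

text \<open>
  Points of \<open>\<int>\<^sup>n\<close> are the elements of \<^term>\<open>carrier_vec n :: int vec set\<close>, indexed from \<open>0\<close> to
  \<open>n - 1\<close>. A function \<open>\<int>\<^sup>n \<rightarrow> \<real> \<union> {+\<infinity>}\<close> is a function \<open>int vec \<Rightarrow> ereal\<close> avoiding \<open>-\<infinity>\<close> on the
  carrier; its values off the carrier are irrelevant to every definition below.
\<close>

definition effdom :: "nat \<Rightarrow> (int vec \<Rightarrow> ereal) \<Rightarrow> int vec set" where
  "effdom n f = {x \<in> carrier_vec n. f x < \<infinity>}"

definition proper_fun :: "nat \<Rightarrow> (int vec \<Rightarrow> ereal) \<Rightarrow> bool" where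
  "proper_fun n f \<longleftrightarrow> (\<forall>x \<in> carrier_vec n. f x \<noteq> -\<infinity>) \<and> effdom n f \<noteq> {}"

definition delta :: "int vec set \<Rightarrow> int vec \<Rightarrow> ereal" where
  "delta S x = (if x \<in> S then 0 else \<infinity>)"

definition vmax :: "int vec \<Rightarrow> int vec \<Rightarrow> int vec" where
  "vmax x y = vec (dim_vec x) (\<lambda>i. max (x $ i) (y $ i))"

definition vmin :: "int vec \<Rightarrow> int vec \<Rightarrow> int vec" where
  "vmin x y = vec (dim_vec x) (\<lambda>i. min (x $ i) (y $ i))"

definition mid_up :: "int vec \<Rightarrow> int vec \<Rightarrow> int vec" where
  "mid_up x y = vec (dim_vec x) (\<lambda>i. \<lceil>real_of_int (x $ i + y $ i) / 2\<rceil>)"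

definition mid_down :: "int vec \<Rightarrow> int vec \<Rightarrow> int vec" where
  "mid_down x y = vec (dim_vec x) (\<lambda>i. \<lfloor>real_of_int (x $ i + y $ i) / 2\<rfloor>)"

text \<open>
  The type \<^typ>\<open>int extended\<close> is \<open>\<int> \<union> {-\<infinity>, +\<infinity>}\<close>, with constructors \<^const>\<open>Fin\<close>, \<^const>\<open>Minf\<close>
  and \<^const>\<open>Pinf\<close>. The side conditions below make every interval and every box nonempty.
\<close>

definition int_interval :: "int set \<Rightarrow> bool" where
  "int_interval I \<longleftrightarrow> (\<exists>a b :: int extended. a \<noteq> Pinf \<and> b \<noteq> Minf \<and> a \<le> b \<and>
     I = {t. a \<le> Fin t \<and> Fin t \<le> b})"

definition int_box :: "nat \<Rightarrow> int vec set \<Rightarrow> bool" where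
  "int_box n S \<longleftrightarrow> (\<exists>a \<in> carrier_vec n. \<exists>b \<in> carrier_vec n.
     (\<forall>i<n. a $ i \<noteq> (Pinf :: int extended) \<and> b $ i \<noteq> Minf \<and> a $ i \<le> b $ i) \<and>
     S = {x \<in> carrier_vec n. \<forall>i<n. a $ i \<le> Fin (x $ i) \<and> Fin (x $ i) \<le> b $ i})"

definition univariate_convex :: "(int \<Rightarrow> ereal) \<Rightarrow> bool" where
  "univariate_convex \<phi> \<longleftrightarrow> (\<forall>t. \<phi> t \<noteq> -\<infinity>) \<and> int_interval {t. \<phi> t < \<infinity>} \<and>
     (\<forall>t. \<phi> (t - 1) + \<phi> (t + 1) \<ge> 2 * \<phi> t)"

definition separable_convex :: "nat \<Rightarrow> (int vec \<Rightarrow> ereal) \<Rightarrow> bool" where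
  "separable_convex n f \<longleftrightarrow> (\<exists>\<phi> :: nat \<Rightarrow> int \<Rightarrow> ereal.
     (\<forall>i<n. univariate_convex (\<phi> i)) \<and>
     (\<forall>x \<in> carrier_vec n. f x = (\<Sum>i<n. \<phi> i (x $ i))))"

definition submodular :: "nat \<Rightarrow> (int vec \<Rightarrow> ereal) \<Rightarrow> bool" where
  "submodular m h \<longleftrightarrow> (\<forall>u \<in> carrier_vec m. \<forall>v \<in> carrier_vec m.
     h u + h v \<ge> h (vmax u v) + h (vmin u v))"

text \<open>
  \<open>consecutive_diffs (x\<^sub>0, x\<^sub>1, \<dots>, x\<^sub>n) = (x\<^sub>1 - x\<^sub>0, \<dots>, x\<^sub>n - x\<^sub>n\<^sub>-\<^sub>1)\<close>.
\<close>

definition consecutive_diffs :: "nat \<Rightarrow> int vec \<Rightarrow> int vec" where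
  "consecutive_diffs n x = vec n (\<lambda>i. x $ Suc i - x $ i)"

definition multimodular :: "nat \<Rightarrow> (int vec \<Rightarrow> ereal) \<Rightarrow> bool" where
  "multimodular n f \<longleftrightarrow> proper_fun n f \<and> submodular (Suc n) (\<lambda>x. f (consecutive_diffs n x))"

definition multimodular_set :: "nat \<Rightarrow> int vec set \<Rightarrow> bool" where
  "multimodular_set n S \<longleftrightarrow> S \<noteq> {} \<and> S \<subseteq> carrier_vec n \<and> multimodular n (delta S)"

definition Lnat_convex :: "nat \<Rightarrow> (int vec \<Rightarrow> ereal) \<Rightarrow> bool" where
  "Lnat_convex n f \<longleftrightarrow> proper_fun n f \<and>
     (\<forall>x \<in> carrier_vec n. \<forall>y \<in> carrier_vec n. f x + f y \<ge> f (mid_up x y) + f (mid_down x y))"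

definition Lnat_convex_set :: "nat \<Rightarrow> int vec set \<Rightarrow> bool" where
  "Lnat_convex_set n S \<longleftrightarrow> S \<noteq> {} \<and> S \<subseteq> carrier_vec n \<and>
     (\<forall>x \<in> S. \<forall>y \<in> S. mid_up x y \<in> S \<and> mid_down x y \<in> S)"

definition L2nat_convex_set :: "nat \<Rightarrow> int vec set \<Rightarrow> bool" where
  "L2nat_convex_set n S \<longleftrightarrow> (\<exists>S1 S2. Lnat_convex_set n S1 \<and> Lnat_convex_set n S2 \<and>
     S = {y + z |y z. y \<in> S1 \<and> z \<in> S2})"

definition inf_conv ::
  "nat \<Rightarrow> (int vec \<Rightarrow> ereal) \<Rightarrow> (int vec \<Rightarrow> ereal) \<Rightarrow> int vec \<Rightarrow> ereal" where
  "inf_conv n f1 f2 x =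
     Inf {f1 y + f2 z |y z. y \<in> carrier_vec n \<and> z \<in> carrier_vec n \<and> y + z = x}"

text \<open>
  \<^const>\<open>inf_conv\<close> may take the value \<open>-\<infinity>\<close>; since \<open>f\<close> is required to be proper, such pairs
  \<open>f1, f2\<close> are excluded.
\<close>

definition L2nat_convex :: "nat \<Rightarrow> (int vec \<Rightarrow> ereal) \<Rightarrow> bool" where
  "L2nat_convex n f \<longleftrightarrow> proper_fun n f \<and>
     (\<exists>f1 f2. Lnat_convex n f1 \<and> Lnat_convex n f2 \<and>
       (\<forall>x \<in> carrier_vec n. f x = inf_conv n f1 f2 x))"

end

theory Submission
  imports Defs
begin

text \<open>
  A multimodular \<open>f\<close> is supermodular in the strong sense \<open>f a + f b \<ge> f w + f (a + b - w)\<close> for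
  \<open>b \<le> w \<le> a\<close>. If \<open>f = f1 \<box> f2\<close> with L-natural-convex (hence submodular) \<open>f1, f2\<close>, then decomposing
  \<open>x = x1 + x2\<close>, \<open>y = y1 + y2\<close> and applying submodularity to each part bounds \<open>f x + f y\<close> from
  below by \<open>f a + f b\<close> with \<open>a = (x1 \<or> y1) + (x2 \<or> y2) \<ge> x \<or> y\<close> and \<open>b = x + y - a \<le> x \<and> y\<close>;
  supermodularity then gives \<open>f x + f y \<ge> f (x \<or> y) + f (x \<and> y)\<close>. So \<open>f\<close> is modular, which means
  separable, and supermodularity along one axis is convexity. Sets are handled through their
  indicators.
\<close>

section \<open>Supermodularity of multimodular functions\<close>

text \<open>Over the reals, adding the two inequalities and cancelling \<open>p + q\<close>
  suffices. In \<open>ereal\<close> the cancellation requires finite \<open>p\<close> and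
  \<open>q\<close>: unless \<open>x + y\<close> is infinite, the third assumption bounds
  \<open>p\<close>, and the second inequality then bounds \<open>q\<close>.\<close>

lemma ereal_exchange_chain:
  fixes x y p q s t :: ereal
  assumes "p + t \<le> x + q" "s + q \<le> p + y" "x + y < \<infinity> \<Longrightarrow> p < \<infinity>"
    and "x \<noteq> -\<infinity>" "y \<noteq> -\<infinity>" "p \<noteq> -\<infinity>" "q \<noteq> -\<infinity>" "s \<noteq> -\<infinity>" "t \<noteq> -\<infinity>"
  shows "s + t \<le> x + y"
proof (cases "x + y = \<infinity>")
  case False
  then obtain x' y' where xy: "x = ereal x'" "y = ereal y'"
    using assms by (cases x; cases y) auto
  obtain p' where p: "p = ereal p'"
    using assms xy by (cases p) auto
  obtain q' s' where qs: "q = ereal q'" "s = ereal s'"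
    using assms xy p by (cases q; cases s) auto
  show ?thesis
    using assms xy p qs by (cases t) auto
qed auto

lemma ereal_summand_finite:
  fixes x y p q :: ereal
  assumes "p + q \<le> x + y" "x + y < \<infinity>" "p \<noteq> -\<infinity>" "q \<noteq> -\<infinity>"
  shows "p < \<infinity>"
  using assms by (cases p; cases q) auto

text \<open>Prefix sums turn any vector into consecutive differences, which makes the submodularity
  behind \<open>multimodular\<close> applicable. As \<open>v\<close> vanishes before
  \<open>i\<close>, its prefix sums are zero up to index \<open>i\<close>, so they do not interfere
  with a shift by -1 on exactly these indices. This is the building block for general
  increments.\<close>

lemma multimodular_unit_step:
  fixes b v :: "nat \<Rightarrow> int"
  assumes mm: "multimodular n f" and i: "i < n"
    and v: "\<And>j. j < n \<Longrightarrow> 0 \<le> v j" "\<And>j. j < i \<Longrightarrow> v j = 0"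
  shows "f (vec n (\<lambda>j. b j + of_bool (j = i))) + f (vec n (\<lambda>j. b j + v j))
       \<le> f (vec n b) + f (vec n (\<lambda>j. b j + of_bool (j = i) + v j))"
proof -
  define P where "P k = (\<Sum>j<k. b j)" for k
  define V where "V k = (\<Sum>j<k. v j)" for k
  have V0: "V k = 0" if "k \<le> i" for k
    using that v(2) by (auto simp: V_def intro!: sum.neutral)
  have Vpos: "0 \<le> V k" if "k \<le> n" for k
    using that v(1) by (auto simp: V_def intro!: sum_nonneg)
  \<comment> \<open>The unit vector at \<open>i\<close> is the difference of both the step \<open>0, 1\<close> and the step \<open>-1, 0\<close>; with the
    latter, the lattice operations on \<open>X\<close> and \<open>Y\<close> separate it from \<open>v\<close>.\<close>
  define X where "X = vec (Suc n) P"
  define Y where "Y = vec (Suc n) (\<lambda>k. P k + (if k \<le> i then -1 else V k))"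
  have "f (consecutive_diffs n (vmax X Y)) + f (consecutive_diffs n (vmin X Y))
      \<le> f (consecutive_diffs n X) + f (consecutive_diffs n Y)"
    using mm unfolding multimodular_def submodular_def X_def Y_def by auto
  moreover have "consecutive_diffs n X = vec n b"
    by (rule eq_vecI) (auto simp: consecutive_diffs_def X_def P_def)
  moreover have "consecutive_diffs n Y = vec n (\<lambda>j. b j + of_bool (j = i) + v j)"
    using V0 v(2) by (intro eq_vecI)
      (auto simp: consecutive_diffs_def Y_def P_def V_def le_Suc_eq not_le)
  moreover have "vmax X Y = vec (Suc n) (\<lambda>k. P k + V k)"
    using Vpos V0 by (intro eq_vecI) (auto simp: vmax_def X_def Y_def)
  then have "consecutive_diffs n (vmax X Y) = vec n (\<lambda>j. b j + v j)"
    by (intro eq_vecI) (auto simp: consecutive_diffs_def P_def V_def)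
  moreover have "vmin X Y = vec (Suc n) (\<lambda>k. P k + (if k \<le> i then -1 else 0))"
    using Vpos by (intro eq_vecI) (auto simp: vmin_def X_def Y_def)
  then have "consecutive_diffs n (vmin X Y) = vec n (\<lambda>j. b j + of_bool (j = i))"
    by (intro eq_vecI) (auto simp: consecutive_diffs_def P_def)
  ultimately show ?thesis
    by (simp add: add.commute)
qed

text \<open>Induction on the total size of \<open>u\<close> and \<open>v\<close>. At the least index
  \<open>i\<close> where one of them is nonzero, say \<open>u\<close>, a unit vector
  \<open>e\<close> is split off: \<open>u = e + u'\<close>. The unit step for \<open>e\<close> and
  \<open>v\<close> at \<open>b\<close>, followed by the induction hypothesis for \<open>u'\<close>
  and \<open>v\<close> at \<open>b + e\<close>, gives the claim.\<close>

lemma multimodular_supermodular_aux: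
  fixes b u v :: "nat \<Rightarrow> int"
  assumes mm: "multimodular n f"
    and "\<And>j. j < n \<Longrightarrow> 0 \<le> u j" "\<And>j. j < n \<Longrightarrow> 0 \<le> v j"
  shows "f (vec n (\<lambda>j. b j + u j)) + f (vec n (\<lambda>j. b j + v j))
       \<le> f (vec n b) + f (vec n (\<lambda>j. b j + u j + v j))"
  using assms(2,3)
proof (induction "nat (\<Sum>j<n. u j + v j)" arbitrary: b u v rule: less_induct)
  case less
  have ne: "f (vec n x) \<noteq> -\<infinity>" for x
    using mm by (auto simp: multimodular_def proper_fun_def)
  show ?case
  proof (cases "\<exists>j<n. u j + v j > 0")
    case False
    then have "u j = 0 \<and> v j = 0" if "j < n" for j
      using less.prems[OF that] that by force
    then have "vec n (\<lambda>j. b j + u j) = vec n b" "vec n (\<lambda>j. b j + v j) = vec n b"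
      "vec n (\<lambda>j. b j + u j + v j) = vec n b"
      by (auto intro!: eq_vecI)
    then show ?thesis by simp
  next
    case True
    define i where "i = (LEAST j. j < n \<and> u j + v j > 0)"
    have i: "i < n" "u i + v i > 0"
      using LeastI_ex[of "\<lambda>j. j < n \<and> u j + v j > 0"] True by (auto simp: i_def)
    have least: "u j = 0 \<and> v j = 0" if "j < i" for j
    proof -
      have "\<not> (j < n \<and> u j + v j > 0)" using that not_less_Least unfolding i_def by blast
      then show ?thesis using less.prems[of j] that i by force
    qed
    \<comment> \<open>\<open>N\<close> freezes the induction measure, because \<open>u\<close> and
      \<open>v\<close> are rebound in the next fact. That fact is stated for fresh \<open>u\<close>
      and \<open>v\<close> so that it also covers the case \<open>v i > 0\<close> with the roles
      exchanged.\<close>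
    define N where "N = nat (\<Sum>j<n. u j + v j)"
    note IH = less.hyps[folded N_def]
    have *: "f (vec n (\<lambda>j. b j + u j)) + f (vec n (\<lambda>j. b j + v j))
       \<le> f (vec n b) + f (vec n (\<lambda>j. b j + u j + v j))"
      if nn: "\<And>j. j < n \<Longrightarrow> 0 \<le> u j" "\<And>j. j < n \<Longrightarrow> 0 \<le> v j"
        and l: "\<And>j. j < i \<Longrightarrow> u j = 0 \<and> v j = 0" and ui: "u i > 0"
        and m: "nat (\<Sum>j<n. u j + v j) = N"
      for u v :: "nat \<Rightarrow> int"
    proof -
      define e where "e j = (of_bool (j = i) :: int)" for j
      define u' where "u' j = u j - e j" for j
      have u': "0 \<le> u' j" if "j < n" for j
        using nn(1)[OF that] ui by (auto simp: u'_def e_def)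
      have "(\<Sum>j<n. u j + v j) = (\<Sum>j<n. u' j + v j) + (\<Sum>j<n. e j)"
        by (simp add: u'_def sum.distrib[symmetric])
      moreover have "(\<Sum>j<n. e j) = 1"
        using i by (simp add: e_def of_bool_def)
      moreover have "0 \<le> (\<Sum>j<n. u' j + v j)"
        using u' nn by (auto intro!: sum_nonneg add_nonneg_nonneg)
      ultimately have dec: "nat (\<Sum>j<n. u' j + v j) < N"
        using m by auto
      have 1: "f (vec n (\<lambda>j. b j + e j)) + f (vec n (\<lambda>j. b j + v j))
         \<le> f (vec n b) + f (vec n (\<lambda>j. b j + e j + v j))"
        unfolding e_def using i nn(2) l by (intro multimodular_unit_step[OF mm]) auto
      have 2: "f (vec n (\<lambda>j. b j + e j + u' j)) + f (vec n (\<lambda>j. b j + e j + v j))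
         \<le> f (vec n (\<lambda>j. b j + e j)) + f (vec n (\<lambda>j. b j + e j + u' j + v j))"
        using IH[OF dec u' nn(2), where b = "\<lambda>j. b j + e j"] by simp
      \<comment> \<open>Both \<open>u'\<close> and \<open>v\<close> vanish before \<open>i\<close>,
        so the unit step also applies to their sum. It is needed only for finiteness of
        \<open>f\<close> at \<open>b + e\<close> when the right-hand side of the claim is
        finite.\<close>
      have 3: "f (vec n (\<lambda>j. b j + e j)) + f (vec n (\<lambda>j. b j + (u' j + v j)))
         \<le> f (vec n b) + f (vec n (\<lambda>j. b j + e j + (u' j + v j)))"
        unfolding e_def using i nn(2) l u' 
        by (intro multimodular_unit_step[OF mm]) (auto simp: u'_def e_def)
      have eq: "b j + e j + u' j = b j + u j" "b j + e j + (u' j + v j) = b j + u j + v j" for j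
        by (auto simp: u'_def)
      show ?thesis
        using ereal_exchange_chain[OF 1 2] ereal_summand_finite[OF 3] ne by (auto simp: eq)
    qed
    show ?thesis
    proof (cases "u i > 0")
      case True
      then show ?thesis
        using less.prems least by (intro *) (auto simp: N_def)
    next
      case False
      then have "v i > 0" using i by auto
      then have "f (vec n (\<lambda>j. b j + v j)) + f (vec n (\<lambda>j. b j + u j))
         \<le> f (vec n b) + f (vec n (\<lambda>j. b j + v j + u j))"
        using less.prems least by (intro *) (auto simp: N_def add.commute)
      then show ?thesis by (simp add: ac_simps)
    qed
  qed
qed

text \<open>Taking \<open>b\<close> as base point, the increments are \<open>w - b\<close> and
  \<open>a - w\<close>, and the sum condition forces \<open>w' = b + (a - w)\<close>.\<close>

lemma multimodular_supermodular:
  assumes mm: "multimodular n f" and c: "{w, w', a, b} \<subseteq> carrier_vec n"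
    and le: "\<And>j. j < n \<Longrightarrow> b $ j \<le> w $ j \<and> w $ j \<le> a $ j" and eq: "w + w' = a + b"
  shows "f w + f w' \<le> f a + f b"
proof -
  have w': "w' $ j = a $ j + b $ j - w $ j" if "j < n" for j
    using arg_cong[OF eq, of "\<lambda>x. x $ j"] c that by auto
  have "f (vec n (\<lambda>j. b $ j + (w $ j - b $ j))) + f (vec n (\<lambda>j. b $ j + (a $ j - w $ j)))
      \<le> f (vec n (\<lambda>j. b $ j)) + f (vec n (\<lambda>j. b $ j + (w $ j - b $ j) + (a $ j - w $ j)))"
    using le by (intro multimodular_supermodular_aux[OF mm]) auto
  moreover have "vec n (\<lambda>j. b $ j + (w $ j - b $ j)) = w"
    "vec n (\<lambda>j. b $ j + (a $ j - w $ j)) = w'" "vec n (\<lambda>j. b $ j) = b"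
    "vec n (\<lambda>j. b $ j + (w $ j - b $ j) + (a $ j - w $ j)) = a"
    using c w' by (auto intro!: eq_vecI)
  ultimately show ?thesis by (simp add: add.commute)
qed

section \<open>Submodularity of L-natural-convex functions\<close>

lemma ceiling_half: "\<lceil>real_of_int s / 2\<rceil> = (s + 1) div 2"
  by linarith

lemma floor_half: "\<lfloor>real_of_int s / 2\<rfloor> = s div 2"
  by linarith

lemma vmax_vmin_mid_index [simp]:
  "i < dim_vec x \<Longrightarrow> vmax x y $ i = max (x $ i) (y $ i)"
  "i < dim_vec x \<Longrightarrow> vmin x y $ i = min (x $ i) (y $ i)"
  "i < dim_vec x \<Longrightarrow> mid_up x y $ i = (x $ i + y $ i + 1) div 2"
  "i < dim_vec x \<Longrightarrow> mid_down x y $ i = (x $ i + y $ i) div 2"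
  using ceiling_half[of "x $ i + y $ i"] floor_half[of "x $ i + y $ i"]
  by (simp_all add: vmax_def vmin_def mid_up_def mid_down_def)

lemma vmax_vmin_mid_dim [simp]:
  "dim_vec (vmax x y) = dim_vec x" "dim_vec (vmin x y) = dim_vec x"
  "dim_vec (mid_up x y) = dim_vec x" "dim_vec (mid_down x y) = dim_vec x"
  by (simp_all add: vmax_def vmin_def mid_up_def mid_down_def)

lemma vmax_vmin_mid_carrier [simp]:
  assumes "x \<in> carrier_vec n"
  shows "vmax x y \<in> carrier_vec n" "vmin x y \<in> carrier_vec n"
    "mid_up x y \<in> carrier_vec n" "mid_down x y \<in> carrier_vec n"
  using assms by (simp_all add: vmax_def vmin_def mid_up_def mid_down_def)

lemma Lnat_convexD:
  "Lnat_convex n g \<Longrightarrow> x \<in> carrier_vec n \<Longrightarrow> y \<in> carrier_vec n \<Longrightarrow>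
    g (mid_up x y) + g (mid_down x y) \<le> g x + g y"
  by (auto simp: Lnat_convex_def)

text \<open>
  Replacing \<open>y\<close> by the rounded-up midpoint of \<open>x\<close> and \<open>y\<close> repeatedly ends in the point below.
\<close>
lemma Lnat_convex_step_finite:
  fixes x y :: "nat \<Rightarrow> int"
  assumes L: "Lnat_convex n g"
    and "g (vec n x) < \<infinity>" "g (vec n y) < \<infinity>"
  shows "g (vec n (\<lambda>j. x j + of_bool (x j < y j))) < \<infinity>"
  using assms(3)
proof (induction "nat (\<Sum>j<n. \<bar>y j - x j\<bar>)" arbitrary: y rule: less_induct)
  case less
  show ?case
  proof (cases "\<forall>j<n. y j - x j \<in> {0, 1}")
    case True
    then have "vec n (\<lambda>j. x j + of_bool (x j < y j)) = vec n y"
      by (intro eq_vecI) force+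
    then show ?thesis using less.prems by simp
  next
    case False
    then obtain k where k: "k < n" "y k - x k \<notin> {0, 1}" by blast
    \<comment> \<open>Rounding the midpoint up keeps differences \<open>y j - x j\<close> equal to 0
      or 1, strictly shrinks all others in absolute value, and preserves whether they are positive.
      So the distance to \<open>x\<close> drops while the target point stays the same.\<close>
    define z where "z j = (x j + y j + 1) div 2" for j
    have zv: "mid_up (vec n x) (vec n y) = vec n z"
      by (intro eq_vecI) (auto simp: z_def)
    have "g (vec n z) + g (mid_down (vec n x) (vec n y)) \<le> g (vec n x) + g (vec n y)"
      using Lnat_convexD[OF L, of "vec n x" "vec n y"] by (simp add: zv)
    moreover have "g (vec n z) \<noteq> -\<infinity>" "g (mid_down (vec n x) (vec n y)) \<noteq> -\<infinity>"
      using L by (auto simp: Lnat_convex_def proper_fun_def)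
    ultimately have fin: "g (vec n z) < \<infinity>"
      using assms(2) less.prems
      by (cases "g (vec n z)"; cases "g (vec n x)"; cases "g (vec n y)") auto
    have "(\<Sum>j<n. \<bar>z j - x j\<bar>) < (\<Sum>j<n. \<bar>y j - x j\<bar>)"
    proof (rule sum_strict_mono_ex1)
      show "\<forall>j\<in>{..<n}. \<bar>z j - x j\<bar> \<le> \<bar>y j - x j\<bar>"
        unfolding z_def by (intro ballI) linarith
      show "\<exists>j\<in>{..<n}. \<bar>z j - x j\<bar> < \<bar>y j - x j\<bar>"
        using k by (intro bexI[of _ k]) (auto simp: z_def)
    qed auto
    moreover have "0 \<le> (\<Sum>j<n. \<bar>z j - x j\<bar>)" by (auto intro: sum_nonneg)
    ultimately have "g (vec n (\<lambda>j. x j + of_bool (x j < z j))) < \<infinity>"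
      by (intro less.hyps[OF _ fin]) linarith
    moreover have "x j < z j \<longleftrightarrow> x j < y j" for j
      unfolding z_def by linarith
    ultimately show ?thesis by simp
  qed
qed

text \<open>Induction on the total size of \<open>u\<close> and \<open>v\<close>. For 0/1 increments
  with disjoint supports, the two rounded midpoints of \<open>b + u\<close> and \<open>b + v\<close>
  are \<open>b + u + v\<close> and \<open>b\<close>, so this is midpoint convexity itself. A larger
  increment is split into two smaller ones whose inequalities are chained.\<close>

lemma Lnat_convex_submodular_aux:
  fixes b u v :: "nat \<Rightarrow> int"
  assumes L: "Lnat_convex n g"
    and "\<And>j. j < n \<Longrightarrow> 0 \<le> u j" "\<And>j. j < n \<Longrightarrow> 0 \<le> v j"
    and "\<And>j. j < n \<Longrightarrow> u j = 0 \<or> v j = 0"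
  shows "g (vec n b) + g (vec n (\<lambda>j. b j + u j + v j))
       \<le> g (vec n (\<lambda>j. b j + u j)) + g (vec n (\<lambda>j. b j + v j))"
  using assms(2-4)
proof (induction "nat (\<Sum>j<n. u j + v j)" arbitrary: b u v rule: less_induct)
  case less
  have ne: "g (vec n x) \<noteq> -\<infinity>" for x
    using L by (auto simp: Lnat_convex_def proper_fun_def)
  \<comment> \<open>Stated for fresh \<open>u\<close> and \<open>v\<close> with the induction
    hypothesis as an assumption, so that it serves both for an entry of \<open>u\<close> and for an
    entry of \<open>v\<close> that is at least 2.\<close>
  have split: "g (vec n b) + g (vec n (\<lambda>j. b j + u j + v j))
       \<le> g (vec n (\<lambda>j. b j + u j)) + g (vec n (\<lambda>j. b j + v j))"
    if nn: "\<And>j. j < n \<Longrightarrow> 0 \<le> u j" "\<And>j. j < n \<Longrightarrow> 0 \<le> v j"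
      and dj: "\<And>j. j < n \<Longrightarrow> u j = 0 \<or> v j = 0"
      and big: "\<exists>k<n. u k \<ge> 2"
      and IH: "\<And>b u' v'. nat (\<Sum>j<n. u' j + v' j) < nat (\<Sum>j<n. u j + v j) \<Longrightarrow>
        (\<And>j. j < n \<Longrightarrow> 0 \<le> u' j) \<Longrightarrow> (\<And>j. j < n \<Longrightarrow> 0 \<le> v' j) \<Longrightarrow>
        (\<And>j. j < n \<Longrightarrow> u' j = 0 \<or> v' j = 0) \<Longrightarrow>
        g (vec n b) + g (vec n (\<lambda>j. b j + u' j + v' j))
        \<le> g (vec n (\<lambda>j. b j + u' j)) + g (vec n (\<lambda>j. b j + v' j))"
    for u v
  proof -
    \<comment> \<open>\<open>e\<close> is the indicator of the support of \<open>u\<close>. An entry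
      of \<open>u\<close> that is at least 2 makes both \<open>e\<close> and the rest
      \<open>w\<close> strictly smaller than \<open>u\<close> in total.\<close>
    define e where "e j = (of_bool (0 < u j) :: int)" for j
    define w where "w j = u j - e j" for j
    obtain k where k: "k < n" "u k \<ge> 2" using big by blast
    have ew: "0 \<le> e j" "0 \<le> w j" "e j = 0 \<or> v j = 0" "w j = 0 \<or> v j = 0"
      "e j \<le> u j" "w j \<le> u j" if "j < n" for j
      using nn[OF that] dj[OF that] by (auto simp: e_def w_def)
    have lt: "nat (\<Sum>j<n. e j + v j) < nat (\<Sum>j<n. u j + v j)"
      "nat (\<Sum>j<n. w j + v j) < nat (\<Sum>j<n. u j + v j)"
    proof -
      have "(\<Sum>j<n. e j + v j) < (\<Sum>j<n. u j + v j)"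
        using ew k by (intro sum_strict_mono_ex1) (auto intro!: bexI[of _ k] simp: e_def)
      moreover have "(\<Sum>j<n. w j + v j) < (\<Sum>j<n. u j + v j)"
        using ew k by (intro sum_strict_mono_ex1) (auto intro!: bexI[of _ k] simp: e_def w_def)
      moreover have "0 \<le> (\<Sum>j<n. e j + v j)" "0 \<le> (\<Sum>j<n. w j + v j)"
        using ew nn by (auto intro!: sum_nonneg add_nonneg_nonneg)
      ultimately show "nat (\<Sum>j<n. e j + v j) < nat (\<Sum>j<n. u j + v j)"
        "nat (\<Sum>j<n. w j + v j) < nat (\<Sum>j<n. u j + v j)" by auto
    qed
    have eq: "b j + e j + w j = b j + u j" "b j + e j + v j = b j + v j + e j" for j
      by (auto simp: w_def)
    have 1: "g (vec n b) + g (vec n (\<lambda>j. b j + e j + v j))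
        \<le> g (vec n (\<lambda>j. b j + e j)) + g (vec n (\<lambda>j. b j + v j))"
      using ew nn by (intro IH[OF lt(1)]) auto
    have 2: "g (vec n (\<lambda>j. b j + e j)) + g (vec n (\<lambda>j. b j + e j + w j + v j))
        \<le> g (vec n (\<lambda>j. b j + e j + w j)) + g (vec n (\<lambda>j. b j + e j + v j))"
      using ew nn by (intro IH[OF lt(2)]) auto
    \<comment> \<open>The middle point of the chain is one unit step from \<open>b + v\<close>
      towards \<open>b + u\<close>: disjoint supports make \<open>v j < u j\<close> equivalent to
      \<open>0 < u j\<close>.\<close>
    have 3: "g (vec n (\<lambda>j. b j + e j + v j)) < \<infinity>"
      if "g (vec n (\<lambda>j. b j + v j)) < \<infinity>" "g (vec n (\<lambda>j. b j + u j)) < \<infinity>"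
    proof -
      have "vec n (\<lambda>j. b j + v j + of_bool (b j + v j < b j + u j)) = vec n (\<lambda>j. b j + e j + v j)"
      proof (intro eq_vecI)
        fix j assume "j < dim_vec (vec n (\<lambda>j. b j + e j + v j))"
        then have "j < n" by simp
        then show "vec n (\<lambda>j. b j + v j + of_bool (b j + v j < b j + u j)) $ j
          = vec n (\<lambda>j. b j + e j + v j) $ j"
          using nn[of j] dj[of j] by (auto simp: e_def)
      qed auto
      then show ?thesis
        using Lnat_convex_step_finite[OF L that] by simp
    qed
    have "g (vec n (\<lambda>j. b j + u j + v j)) + g (vec n b)
      \<le> g (vec n (\<lambda>j. b j + v j)) + g (vec n (\<lambda>j. b j + u j))"
    proof (rule ereal_exchange_chain)
      show "g (vec n (\<lambda>j. b j + e j + v j)) + g (vec n b)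
        \<le> g (vec n (\<lambda>j. b j + v j)) + g (vec n (\<lambda>j. b j + e j))"
        using 1 by (simp add: add.commute)
      show "g (vec n (\<lambda>j. b j + u j + v j)) + g (vec n (\<lambda>j. b j + e j))
        \<le> g (vec n (\<lambda>j. b j + e j + v j)) + g (vec n (\<lambda>j. b j + u j))"
        using 2 by (simp add: w_def add.commute)
    qed (use 3 ne in auto)
    then show ?thesis by (simp add: add.commute)
  qed
  consider "\<exists>k<n. u k \<ge> 2" | "\<exists>k<n. v k \<ge> 2" | "\<forall>k<n. u k \<le> 1 \<and> v k \<le> 1"
    by force
  then show ?case
  proof cases
    case 1
    then show ?thesis using less by (intro split) auto
  next
    case 2
    have "g (vec n b) + g (vec n (\<lambda>j. b j + v j + u j))
       \<le> g (vec n (\<lambda>j. b j + v j)) + g (vec n (\<lambda>j. b j + u j))"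
      using 2 less.prems less.hyps by (intro split) (auto simp: add.commute[of "v _" "u _"])
    then show ?thesis by (simp add: ac_simps)
  next
    case 3
    have r: "u j = 0 \<and> v j = 0 \<or> u j = 1 \<and> v j = 0 \<or> u j = 0 \<and> v j = 1" if "j < n" for j
      using 3 that less.prems[OF that] by force
    define X where "X = vec n (\<lambda>j. b j + u j)"
    define Y where "Y = vec n (\<lambda>j. b j + v j)"
    have "mid_up X Y = vec n (\<lambda>j. b j + u j + v j)" "mid_down X Y = vec n b"
      using r by (auto intro!: eq_vecI simp: X_def Y_def) force+
    then show ?thesis
      using Lnat_convexD[OF L, of X Y] by (simp add: X_def Y_def add.commute)
  qed
qed

text \<open>The increments from \<open>vmin x y\<close> to \<open>x\<close> and to \<open>y\<close>
  have disjoint supports, and adding both of them leads to \<open>vmax x y\<close>.\<close>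

lemma Lnat_convex_submodular:
  assumes L: "Lnat_convex n g" and c: "x \<in> carrier_vec n" "y \<in> carrier_vec n"
  shows "g (vmax x y) + g (vmin x y) \<le> g x + g y"
proof -
  define b where "b j = min (x $ j) (y $ j)" for j
  have "g (vec n b) + g (vec n (\<lambda>j. b j + (x $ j - b j) + (y $ j - b j)))
     \<le> g (vec n (\<lambda>j. b j + (x $ j - b j))) + g (vec n (\<lambda>j. b j + (y $ j - b j)))"
    by (intro Lnat_convex_submodular_aux[OF L]) (auto simp: b_def)
  moreover have "vec n b = vmin x y" "vec n (\<lambda>j. b j + (x $ j - b j)) = x"
    "vec n (\<lambda>j. b j + (y $ j - b j)) = y"
    "vec n (\<lambda>j. b j + (x $ j - b j) + (y $ j - b j)) = vmax x y"
    using c by (auto intro!: eq_vecI simp: b_def)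
  ultimately show ?thesis by (simp add: add.commute)
qed

section \<open>Infimal convolution and the modular identity\<close>

lemma inf_conv_lower:
  "y \<in> carrier_vec n \<Longrightarrow> z \<in> carrier_vec n \<Longrightarrow> inf_conv n f1 f2 (y + z) \<le> f1 y + f2 z"
  unfolding inf_conv_def by (intro Inf_lower) auto

lemma inf_conv_lessE:
  assumes "inf_conv n f1 f2 x < c"
  obtains y z where "y \<in> carrier_vec n" "z \<in> carrier_vec n" "x = y + z" "f1 y + f2 z < c"
  using assms unfolding inf_conv_def Inf_less_iff by auto

text \<open>The infimum in \<open>inf_conv\<close> need not be attained. The argument is therefore
  by contradiction, with decompositions of \<open>x\<close> and \<open>y\<close> that are optimal up
  to a slack \<open>e\<close>.\<close>

lemma multimodular_L2nat_submodular:
  assumes mm: "multimodular n f" and L2: "L2nat_convex n f"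
    and x: "x \<in> carrier_vec n" and y: "y \<in> carrier_vec n"
  shows "f (vmax x y) + f (vmin x y) \<le> f x + f y"
proof (rule ccontr)
  obtain f1 f2 where L: "Lnat_convex n f1" "Lnat_convex n f2"
    and f: "\<And>x. x \<in> carrier_vec n \<Longrightarrow> f x = inf_conv n f1 f2 x"
    using L2 by (auto simp: L2nat_convex_def)
  have ne: "f x \<noteq> -\<infinity>" "f y \<noteq> -\<infinity>"
    using mm x y by (auto simp: multimodular_def proper_fun_def)
  have ne12: "f1 z \<noteq> -\<infinity>" "f2 z \<noteq> -\<infinity>" if "z \<in> carrier_vec n" for z
    using that L by (auto simp: Lnat_convex_def proper_fun_def)
  assume "\<not> ?thesis"
  then have "f x + f y < f (vmax x y) + f (vmin x y)" by simp
  then obtain r where r: "f x + f y < ereal r" "ereal r < f (vmax x y) + f (vmin x y)"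
    using ereal_dense2 by blast
  obtain p q where pq: "f x = ereal p" "f y = ereal q"
    using r ne by (cases "f x"; cases "f y") auto
  \<comment> \<open>Half of the gap between \<open>f x + f y\<close> and \<open>r\<close>, so that
    the two slacks together reach exactly \<open>r\<close>.\<close>
  define e where "e = (r - p - q) / 2"
  have "e > 0" using r pq by (simp add: e_def)
  then have lt: "inf_conv n f1 f2 x < ereal (p + e)" "inf_conv n f1 f2 y < ereal (q + e)"
    unfolding f[OF x, symmetric] f[OF y, symmetric] pq by auto
  obtain x1 x2 where cx: "x1 \<in> carrier_vec n" "x2 \<in> carrier_vec n" and dx: "x = x1 + x2"
    and ltx: "f1 x1 + f2 x2 < ereal (p + e)"
    using lt(1) by (rule inf_conv_lessE)
  obtain y1 y2 where cy: "y1 \<in> carrier_vec n" "y2 \<in> carrier_vec n" and dy: "y = y1 + y2"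
    and lty: "f1 y1 + f2 y2 < ereal (q + e)"
    using lt(2) by (rule inf_conv_lessE)
  note c = cx cy and dec = dx dy
  define a where "a = vmax x1 y1 + vmax x2 y2"
  define b where "b = vmin x1 y1 + vmin x2 y2"
  \<comment> \<open>The required order \<open>b \<le> vmax x y \<le> a\<close> holds because a
    maximum of sums is at most the sum of the maxima, and dually for minima.\<close>
  have "f (vmax x y) + f (vmin x y) \<le> f a + f b"
  proof (rule multimodular_supermodular[OF mm])
    show "vmax x y + vmin x y = a + b"
      using c by (intro eq_vecI) (auto simp: a_def b_def dec)
  qed (use c in \<open>auto simp: a_def b_def dec\<close>)
  also have "\<dots> \<le> (f1 (vmax x1 y1) + f2 (vmax x2 y2)) + (f1 (vmin x1 y1) + f2 (vmin x2 y2))"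
    using c f unfolding a_def b_def by (intro add_mono) (auto intro!: inf_conv_lower)
  also have "\<dots> = (f1 (vmax x1 y1) + f1 (vmin x1 y1)) + (f2 (vmax x2 y2) + f2 (vmin x2 y2))"
    by (simp add: ac_simps)
  also have "\<dots> \<le> (f1 x1 + f1 y1) + (f2 x2 + f2 y2)"
    using c by (intro add_mono[OF Lnat_convex_submodular[OF L(1)] Lnat_convex_submodular[OF L(2)]])
  also have "\<dots> = (f1 x1 + f2 x2) + (f1 y1 + f2 y2)"
    by (simp add: ac_simps)
  also have "\<dots> \<le> ereal (p + e) + ereal (q + e)"
    using ltx lty by (intro add_mono) auto
  also have "\<dots> = ereal r"
    by (simp add: e_def field_simps)
  finally show False using r by simp
qed

text \<open>The inequality opposite to submodularity is supermodularity with \<open>x\<close> lying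
  between \<open>vmin x y\<close> and \<open>vmax x y\<close>.\<close>

lemma multimodular_L2nat_modular:
  assumes mm: "multimodular n f" and L2: "L2nat_convex n f"
    and x: "x \<in> carrier_vec n" and y: "y \<in> carrier_vec n"
  shows "f x + f y = f (vmax x y) + f (vmin x y)"
proof (rule antisym)
  show "f x + f y \<le> f (vmax x y) + f (vmin x y)"
  proof (rule multimodular_supermodular[OF mm])
    show "x + y = vmax x y + vmin x y"
      using x y by (intro eq_vecI) auto
  qed (use x y in auto)
qed (rule multimodular_L2nat_submodular[OF assms])

section \<open>Integer intervals and boxes\<close>

lemma int_set_has_least:
  fixes I :: "int set"
  assumes "s \<in> I" "\<And>t. t \<in> I \<Longrightarrow> r \<le> t"
  shows "\<exists>m\<in>I. \<forall>t\<in>I. m \<le> t"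
proof -
  have "\<exists>m. m \<in> I \<and> (\<forall>t. t \<in> I \<longrightarrow> nat (m - r) \<le> nat (t - r))"
    using ex_has_least_nat[of "\<lambda>t. t \<in> I" s "\<lambda>t. nat (t - r)"] assms(1) by blast
  then obtain m where m: "m \<in> I" "\<forall>t. t \<in> I \<longrightarrow> nat (m - r) \<le> nat (t - r)"
    by blast
  have "m \<le> t" if "t \<in> I" for t
  proof -
    have "nat (m - r) \<le> nat (t - r)" "r \<le> t" "r \<le> m" using m that assms(2) by blast+
    then show ?thesis by linarith
  qed
  then show ?thesis using m(1) by blast
qed

lemma int_set_has_greatest:
  fixes I :: "int set"
  assumes "s \<in> I" "\<And>t. t \<in> I \<Longrightarrow> t \<le> r"
  shows "\<exists>m\<in>I. \<forall>t\<in>I. t \<le> m"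
proof -
  have "\<exists>m\<in>uminus ` I. \<forall>t\<in>uminus ` I. m \<le> t"
    by (rule int_set_has_least[of "-s" _ "-r"]) (use assms in auto)
  then obtain m where "m \<in> I" "\<forall>t\<in>uminus ` I. -m \<le> t" by blast
  then show ?thesis by (intro bexI[of _ m]) auto
qed

text \<open>Order-convexity replaces the extended endpoints, so later arguments need no distinction
  between finite and infinite bounds.\<close>

lemma int_interval_iff:
  "int_interval I \<longleftrightarrow> I \<noteq> {} \<and> (\<forall>s\<in>I. \<forall>t\<in>I. \<forall>r. s \<le> r \<and> r \<le> t \<longrightarrow> r \<in> I)"
  (is "_ \<longleftrightarrow> ?R")
proof
  assume "int_interval I"
  then obtain a b where ab: "a \<noteq> Pinf" "b \<noteq> Minf" "a \<le> b" "I = {t. a \<le> Fin t \<and> Fin t \<le> b}"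
    by (auto simp: int_interval_def)
  have "\<exists>t. a \<le> Fin t \<and> Fin t \<le> b"
    using ab(1-3) by (cases a; cases b) auto
  moreover have "a \<le> Fin r \<and> Fin r \<le> b" if "a \<le> Fin s" "Fin t \<le> b" "s \<le> r" "r \<le> t" for r s t
    using that by (cases a; cases b) auto
  ultimately show ?R unfolding ab(4) by blast
next
  assume R: ?R
  then obtain s where s: "s \<in> I" by auto
  \<comment> \<open>\<open>a\<close> is the least element of \<open>I\<close>, or
    \<open>Minf\<close> if there is none. The third property holds in both cases: every point not
    below \<open>a\<close> has an element of \<open>I\<close> at or below it.\<close>
  obtain a where a: "a \<noteq> Pinf" "\<And>t. t \<in> I \<Longrightarrow> a \<le> Fin t" "\<And>t. a \<le> Fin t \<Longrightarrow> \<exists>l\<in>I. l \<le> t"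
  proof (cases "\<exists>m\<in>I. \<forall>t\<in>I. m \<le> t")
    case True
    then obtain m where "m \<in> I" "\<forall>t\<in>I. m \<le> t" by blast
    then show ?thesis by (intro that[of "Fin m"]) auto
  next
    case False
    have "\<exists>l\<in>I. l \<le> r" for r
    proof (rule ccontr)
      assume "\<not> ?thesis"
      then have "r \<le> t" if "t \<in> I" for t using that by force
      then show False using int_set_has_least[OF s] False by blast
    qed
    then show ?thesis by (intro that[of Minf]) simp_all
  qed
  obtain b where b: "b \<noteq> Minf" "\<And>t. t \<in> I \<Longrightarrow> Fin t \<le> b" "\<And>t. Fin t \<le> b \<Longrightarrow> \<exists>u\<in>I. t \<le> u"
  proof (cases "\<exists>m\<in>I. \<forall>t\<in>I. t \<le> m")
    case True
    then obtain m where "m \<in> I" "\<forall>t\<in>I. t \<le> m" by blast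
    then show ?thesis by (intro that[of "Fin m"]) auto
  next
    case False
    have "\<exists>u\<in>I. r \<le> u" for r
    proof (rule ccontr)
      assume "\<not> ?thesis"
      then have "t \<le> r" if "t \<in> I" for t using that by force
      then show False using int_set_has_greatest[OF s] False by blast
    qed
    then show ?thesis by (intro that[of Pinf]) simp_all
  qed
  have "t \<in> I" if t: "a \<le> Fin t" "Fin t \<le> b" for t
  proof -
    obtain l u where "l \<in> I" "l \<le> t" "u \<in> I" "t \<le> u" using a(3)[OF t(1)] b(3)[OF t(2)] by blast
    then show ?thesis using R by blast
  qed
  then have "I = {t. a \<le> Fin t \<and> Fin t \<le> b}" using a(2) b(2) by blast
  moreover have "a \<le> b" using a(2)[OF s] b(2)[OF s] by (rule order_trans)
  ultimately show "int_interval I" using a(1) b(1) unfolding int_interval_def by blast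
qed

lemma int_box_iff:
  "int_box n S \<longleftrightarrow> (\<exists>I. (\<forall>i<n. int_interval (I i)) \<and> S = {x \<in> carrier_vec n. \<forall>i<n. x $ i \<in> I i})"
proof
  assume "int_box n S"
  then obtain a b :: "int extended vec" where
    ab: "\<forall>i<n. a $ i \<noteq> Pinf \<and> b $ i \<noteq> Minf \<and> a $ i \<le> b $ i"
    and S: "S = {x \<in> carrier_vec n. \<forall>i<n. a $ i \<le> Fin (x $ i) \<and> Fin (x $ i) \<le> b $ i}"
    unfolding int_box_def by blast
  show "\<exists>I. (\<forall>i<n. int_interval (I i)) \<and> S = {x \<in> carrier_vec n. \<forall>i<n. x $ i \<in> I i}"
  proof (intro exI conjI allI impI)
    show "int_interval {t. a $ i \<le> Fin t \<and> Fin t \<le> b $ i}" if "i < n" for i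
      using ab that unfolding int_interval_def by blast
  qed (simp add: S)
next
  assume "\<exists>I. (\<forall>i<n. int_interval (I i)) \<and> S = {x \<in> carrier_vec n. \<forall>i<n. x $ i \<in> I i}"
  then obtain I where I: "\<forall>i<n. int_interval (I i)"
    and S: "S = {x \<in> carrier_vec n. \<forall>i<n. x $ i \<in> I i}" by blast
  \<comment> \<open>An opaque name for the endpoint condition, so that the choice of endpoints for
    all \<open>i\<close> does not have to look inside it.\<close>
  define Q where "Q J a b \<longleftrightarrow> a \<noteq> Pinf \<and> b \<noteq> Minf \<and> a \<le> b \<and> J = {t. a \<le> Fin t \<and> Fin t \<le> b}"
    for J and a b :: "int extended"
  have "\<forall>i<n. \<exists>a b. Q (I i) a b"
    using I unfolding int_interval_def Q_def .
  then obtain a b where "\<forall>i<n. Q (I i) (a i) (b i)"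
    by metis
  then have ab: "\<forall>i<n. a i \<noteq> Pinf \<and> b i \<noteq> Minf \<and> a i \<le> b i \<and>
      I i = {t. a i \<le> Fin t \<and> Fin t \<le> b i}"
    unfolding Q_def .
  have "S = {x \<in> carrier_vec n. \<forall>i<n. vec n a $ i \<le> Fin (x $ i) \<and> Fin (x $ i) \<le> vec n b $ i}"
    unfolding S using ab by (intro Collect_cong conj_cong all_cong) auto
  moreover have "\<forall>i<n. vec n a $ i \<noteq> Pinf \<and> vec n b $ i \<noteq> Minf \<and> vec n a $ i \<le> vec n b $ i"
    using ab by simp
  ultimately show "int_box n S"
    unfolding int_box_def using vec_carrier by blast
qed

section \<open>Separability of modular functions\<close>

text \<open>Around a point \<open>z\<close> with finite value, modularity makes the effect of
  changing one coordinate independent of the others. Hence \<open>f\<close> is the sum of its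
  restrictions to the axis lines through \<open>z\<close>, up to multiples of the constant
  \<open>f z\<close>. Each restriction is convex by supermodularity along its line.\<close>

lemma modular_separable:
  assumes n: "n \<ge> 1" and mm: "multimodular n f"
    and modular: "\<And>x y. x \<in> carrier_vec n \<Longrightarrow> y \<in> carrier_vec n \<Longrightarrow>
      f x + f y = f (vmax x y) + f (vmin x y)"
  shows "separable_convex n f"
proof -
  define H where "H x = f (vec n x)" for x
  have ne: "H x \<noteq> -\<infinity>" for x
    using mm by (auto simp: H_def multimodular_def proper_fun_def)
  \<comment> \<open>Swapping some coordinates between two points changes neither their componentwise
    maximum nor their minimum.\<close>
  have exchange: "H x + H y = H x' + H y'"
    if "\<And>j. j < n \<Longrightarrow> x' j = x j \<and> y' j = y j \<or> x' j = y j \<and> y' j = x j" for x y x' y'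
  proof -
    have "vmax (vec n x) (vec n y) = vmax (vec n x') (vec n y')"
      "vmin (vec n x) (vec n y) = vmin (vec n x') (vec n y')"
      using that by (auto intro!: eq_vecI) force+
    then show ?thesis
      using modular[of "vec n x" "vec n y"] modular[of "vec n x'" "vec n y'"] by (simp add: H_def)
  qed
  have super: "H w + H w' \<le> H a + H b"
    if "\<And>j. j < n \<Longrightarrow> b j \<le> w j \<and> w j \<le> a j \<and> w j + w' j = a j + b j" for w w' a b
    unfolding H_def using that by (intro multimodular_supermodular[OF mm]) (auto intro!: eq_vecI)
  obtain z where "z \<in> carrier_vec n" "f z < \<infinity>"
    using mm by (auto simp: multimodular_def proper_fun_def effdom_def)
  moreover from this have "vec n (($) z) = z" by (intro eq_vecI) auto
  ultimately obtain c where c: "H (($) z) = ereal c"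
    using ne[of "($) z"] by (cases "H (($) z)") (auto simp: H_def)
  \<comment> \<open>Every restriction contributes the value \<open>c\<close> at \<open>z\<close>;
    subtracting it for all indices but 0 leaves it counted exactly once.\<close>
  define k where "k i = (if i = 0 then 0 else c)" for i :: nat
  define \<phi> where "\<phi> i t = H ((($) z)(i := t)) - ereal (k i)" for i t
  have phi_fin: "\<phi> i t < \<infinity> \<longleftrightarrow> H ((($) z)(i := t)) < \<infinity>" for i t
    unfolding \<phi>_def by (cases "H ((($) z)(i := t))") auto
  have "univariate_convex (\<phi> i)" if "i < n" for i
    unfolding univariate_convex_def
  proof (intro conjI allI)
    show "\<phi> i t \<noteq> -\<infinity>" for t
      using ne[of "(($) z)(i := t)"] unfolding \<phi>_def by (cases "H ((($) z)(i := t))") auto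
    have "z $ i \<in> {t. \<phi> i t < \<infinity>}" unfolding mem_Collect_eq phi_fin using c by simp
    moreover have "\<phi> i r < \<infinity>" if st: "\<phi> i s < \<infinity>" "\<phi> i t < \<infinity>" "s \<le> r" "r \<le> t" for r s t
    proof -
      have "H ((($) z)(i := r)) + H ((($) z)(i := s + t - r)) \<le> H ((($) z)(i := t)) + H ((($) z)(i := s))"
        using st by (intro super) auto
      then show ?thesis using st ne unfolding phi_fin by (auto dest!: ereal_summand_finite)
    qed
    ultimately show "int_interval {t. \<phi> i t < \<infinity>}"
      unfolding int_interval_iff by blast
    show "2 * \<phi> i t \<le> \<phi> i (t - 1) + \<phi> i (t + 1)" for t
    proof -
      have "H ((($) z)(i := t)) + H ((($) z)(i := t)) \<le> H ((($) z)(i := t + 1)) + H ((($) z)(i := t - 1))"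
        by (intro super) auto
      then show ?thesis
        using ne[of "(($) z)(i := t)"] ne[of "(($) z)(i := t + 1)"] ne[of "(($) z)(i := t - 1)"]
        unfolding \<phi>_def
        by (cases "H ((($) z)(i := t))"; cases "H ((($) z)(i := t + 1))"; cases "H ((($) z)(i := t - 1))")
          auto
    qed
  qed
  moreover have "f x = (\<Sum>i<n. \<phi> i (x $ i))" if x: "x \<in> carrier_vec n" for x
  proof -
    \<comment> \<open>\<open>X m\<close> follows \<open>x\<close> below \<open>m\<close> and
      \<open>z\<close> from \<open>m\<close> on. The induction on the partial sums starts at
      \<open>Suc 0\<close>, since the empty sum is 0 whereas \<open>H (X 0)\<close> is
      \<open>c\<close>.\<close>
    define X where "X m j = (if j < m then x $ j else z $ j)" for m j
    have "(\<Sum>i<Suc m. \<phi> i (x $ i)) = H (X (Suc m))" for m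
    proof (induction m)
      case 0
      have X0: "X (Suc 0) = (($) z)(0 := x $ 0)" by (auto simp: X_def)
      have "(\<Sum>i<Suc 0. \<phi> i (x $ i)) = \<phi> 0 (x $ 0)" by simp
      also have "\<dots> = H ((($) z)(0 := x $ 0))"
        unfolding \<phi>_def k_def by (cases "H ((($) z)(0 := x $ 0))") auto
      finally show ?case by (simp only: X0)
    next
      case (Suc m)
      \<comment> \<open>Only coordinate \<open>Suc m\<close> is swapped between the two
        points.\<close>
      have "H (X (Suc (Suc m))) + H (($) z) = H (X (Suc m)) + H ((($) z)(Suc m := x $ Suc m))"
        by (rule exchange) (auto simp: X_def)
      then have "H (X (Suc m)) + \<phi> (Suc m) (x $ Suc m) = H (X (Suc (Suc m)))"
        using c ne[of "X (Suc m)"] ne[of "X (Suc (Suc m))"] ne[of "(($) z)(Suc m := x $ Suc m)"]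
        unfolding \<phi>_def k_def
        by (cases "H (X (Suc m))"; cases "H (X (Suc (Suc m)))";
            cases "H ((($) z)(Suc m := x $ Suc m))") auto
      then show ?case using Suc by simp
    qed
    from this[of "n - 1"] have "(\<Sum>i<n. \<phi> i (x $ i)) = H (X n)" using n by simp
    moreover have "vec n (X n) = x" using x by (intro eq_vecI) (auto simp: X_def)
    ultimately show ?thesis by (simp add: H_def)
  qed
  ultimately show ?thesis unfolding separable_convex_def by blast
qed

section \<open>Exchange inequalities for separable convex functions\<close>

lemma univariate_convex_finite:
  assumes "univariate_convex \<phi>" "\<phi> s < \<infinity>" "\<phi> t < \<infinity>" "s \<le> r" "r \<le> t"
  shows "\<phi> r < \<infinity>"
  using assms unfolding univariate_convex_def int_interval_iff mem_Collect_eq by blast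

text \<open>Lengthens one of the two increments from 1 to \<open>k\<close> by chaining the given
  inequality at \<open>s\<close> with the induction hypothesis at \<open>s + 1\<close>. The
  intermediate value at \<open>s + 1\<close> is finite because the effective domain is an
  interval.\<close>

lemma univariate_convex_exchange_chain:
  fixes \<phi> :: "int \<Rightarrow> ereal" and m k :: nat
  assumes cv: "univariate_convex \<phi>"
    and step: "\<And>s :: int. \<phi> (s + 1) + \<phi> (s + m) \<le> \<phi> s + \<phi> (s + 1 + m)"
  shows "\<phi> (s + int k) + \<phi> (s + m) \<le> \<phi> s + \<phi> (s + k + m)"
proof (induction k arbitrary: s)
  case (Suc k)
  have ne: "\<phi> t \<noteq> -\<infinity>" for t using cv by (auto simp: univariate_convex_def)
  have "\<phi> (s + 1 + k) + \<phi> (s + m) \<le> \<phi> s + \<phi> (s + 1 + k + m)"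
  proof (rule ereal_exchange_chain[OF step Suc.IH])
    assume "\<phi> s + \<phi> (s + 1 + k + m) < \<infinity>"
    then have "\<phi> s < \<infinity>" "\<phi> (s + 1 + k + m) < \<infinity>"
      using ne by auto
    then show "\<phi> (s + 1) < \<infinity>"
      by (rule univariate_convex_finite[OF cv]) auto
  qed (use ne in auto)
  then show ?case by (simp add: ac_simps)
qed simp

lemma univariate_convex_exchange:
  fixes \<phi> :: "int \<Rightarrow> ereal"
  assumes cv: "univariate_convex \<phi>" and "s \<le> s'" "s' \<le> t" "s' + t' = s + t"
  shows "\<phi> s' + \<phi> t' \<le> \<phi> s + \<phi> t"
proof -
  have two: "2 * a = a + a" for a :: ereal by (cases a) auto
  have conv: "2 * \<phi> t \<le> \<phi> (t - 1) + \<phi> (t + 1)" for t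
    using cv by (auto simp: univariate_convex_def)
  have "\<phi> (s + 1) + \<phi> (s + 1) \<le> \<phi> s + \<phi> (s + 1 + 1)" for s
    using conv[of "s + 1"] unfolding two by simp
  \<comment> \<open>The chain lemma is applied twice: first to lengthen one increment against a unit
    increment, then, with the roles exchanged by commutativity, to lengthen the other.\<close>
  then have "\<phi> (s + int k) + \<phi> (s + int 1) \<le> \<phi> s + \<phi> (s + int k + int 1)" for s k
    by (intro univariate_convex_exchange_chain[OF cv]) simp
  then have "\<phi> (s + int k) + \<phi> (s + int m) \<le> \<phi> s + \<phi> (s + int k + int m)" for s k m
    by (intro univariate_convex_exchange_chain[OF cv]) (simp add: ac_simps)
  from this[of s "nat (s' - s)" "nat (t - s')"]
  have "\<phi> (s + int (nat (s' - s))) + \<phi> (s + int (nat (t - s')))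
      \<le> \<phi> s + \<phi> (s + int (nat (s' - s)) + int (nat (t - s')))" .
  moreover have "s + int (nat (s' - s)) = s'" "s + int (nat (t - s')) = t'"
    "s' + int (nat (t - s')) = t"
    using assms(2-4) by auto
  ultimately show ?thesis by metis
qed

text \<open>Common source of multimodularity and L-natural-convexity: in both definitions each
  coordinate pair is replaced by one with the same sum that lies between the old values.\<close>

lemma separable_convex_exchange:
  assumes sep: "separable_convex n f" and c: "{x, y, x', y'} \<subseteq> carrier_vec n"
    and btw: "\<And>i. i < n \<Longrightarrow> x' $ i + y' $ i = x $ i + y $ i \<and>
      min (x $ i) (y $ i) \<le> x' $ i \<and> x' $ i \<le> max (x $ i) (y $ i)"
  shows "f x' + f y' \<le> f x + f y"
proof -
  obtain \<phi> where cv: "\<And>i. i < n \<Longrightarrow> univariate_convex (\<phi> i)"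
    and f: "\<And>x. x \<in> carrier_vec n \<Longrightarrow> f x = (\<Sum>i<n. \<phi> i (x $ i))"
    using sep by (auto simp: separable_convex_def)
  have "\<phi> i (x' $ i) + \<phi> i (y' $ i) \<le> \<phi> i (x $ i) + \<phi> i (y $ i)" if "i < n" for i
  proof (cases "x $ i \<le> y $ i")
    case True
    then show ?thesis using btw[OF that] by (intro univariate_convex_exchange cv that) auto
  next
    case False
    then have "\<phi> i (x' $ i) + \<phi> i (y' $ i) \<le> \<phi> i (y $ i) + \<phi> i (x $ i)"
      using btw[OF that] by (intro univariate_convex_exchange cv that) auto
    then show ?thesis by (simp add: add.commute)
  qed
  then have "(\<Sum>i<n. \<phi> i (x' $ i) + \<phi> i (y' $ i)) \<le> (\<Sum>i<n. \<phi> i (x $ i) + \<phi> i (y $ i))"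
    by (intro sum_mono) auto
  then show ?thesis using c f by (simp add: sum.distrib)
qed

lemma separable_convex_multimodular:
  assumes "proper_fun n f" "separable_convex n f"
  shows "multimodular n f"
  unfolding multimodular_def submodular_def
proof (intro conjI ballI assms(1))
  fix u v :: "int vec"
  assume "u \<in> carrier_vec (Suc n)" "v \<in> carrier_vec (Suc n)"
  then show "f (consecutive_diffs n (vmax u v)) + f (consecutive_diffs n (vmin u v))
      \<le> f (consecutive_diffs n u) + f (consecutive_diffs n v)"
    by (intro separable_convex_exchange[OF assms(2)])
      (auto simp: consecutive_diffs_def min_def max_def)
qed

lemma separable_convex_Lnat_convex:
  assumes "proper_fun n f" "separable_convex n f"
  shows "Lnat_convex n f"
  unfolding Lnat_convex_def
proof (intro conjI ballI assms(1))
  fix x y :: "int vec"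
  assume "x \<in> carrier_vec n" "y \<in> carrier_vec n"
  then show "f (mid_up x y) + f (mid_down x y) \<le> f x + f y"
    by (intro separable_convex_exchange[OF assms(2)]) (auto simp: min_def max_def)
qed

section \<open>Indicators, Minkowski sums and the passage between sets and functions\<close>

lemma proper_fun_delta: "S \<noteq> {} \<Longrightarrow> S \<subseteq> carrier_vec n \<Longrightarrow> proper_fun n (delta S)"
  by (auto simp: proper_fun_def effdom_def delta_def)

lemma Lnat_convex_delta: "Lnat_convex_set n S \<Longrightarrow> Lnat_convex n (delta S)"
  by (auto simp: Lnat_convex_def Lnat_convex_set_def intro: proper_fun_delta) (auto simp: delta_def)

text \<open>The origin is the neutral summand, both for Minkowski sums and, through its indicator,
  for infimal convolution.\<close>

lemma Lnat_convex_set_zero: "Lnat_convex_set n {0\<^sub>v n}"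
  by (auto simp: Lnat_convex_set_def intro!: eq_vecI)

lemma Lnat_convex_imp_L2nat_convex:
  assumes L: "Lnat_convex n f"
  shows "L2nat_convex n f"
proof -
  have pf: "proper_fun n f" using L by (simp add: Lnat_convex_def)
  have "f x = inf_conv n f (delta {0\<^sub>v n}) x" if x: "x \<in> carrier_vec n" for x
  proof (rule antisym)
    show "f x \<le> inf_conv n f (delta {0\<^sub>v n}) x"
      unfolding inf_conv_def
    proof (rule Inf_greatest, safe)
      fix y z :: "int vec"
      assume yz: "y \<in> carrier_vec n" "z \<in> carrier_vec n"
      show "f (y + z) \<le> f y + delta {0\<^sub>v n} z"
        using pf yz by (cases "z = 0\<^sub>v n") (auto simp: delta_def proper_fun_def)
    qed
    show "inf_conv n f (delta {0\<^sub>v n}) x \<le> f x"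
      using inf_conv_lower[OF x, of "0\<^sub>v n" f "delta {0\<^sub>v n}"] x by (simp add: delta_def)
  qed
  then show ?thesis
    using L pf Lnat_convex_delta[OF Lnat_convex_set_zero] unfolding L2nat_convex_def by blast
qed

lemma L2nat_convex_delta:
  assumes L2: "L2nat_convex_set n S"
  shows "L2nat_convex n (delta S)"
proof -
  obtain S1 S2 where L: "Lnat_convex_set n S1" "Lnat_convex_set n S2"
    and S: "S = {y + z |y z. y \<in> S1 \<and> z \<in> S2}"
    using L2 unfolding L2nat_convex_set_def by blast
  have c: "S1 \<noteq> {}" "S2 \<noteq> {}" "S1 \<subseteq> carrier_vec n" "S2 \<subseteq> carrier_vec n"
    using L by (auto simp: Lnat_convex_set_def)
  have "delta S x = inf_conv n (delta S1) (delta S2) x" for x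
  proof (rule antisym)
    show "delta S x \<le> inf_conv n (delta S1) (delta S2) x"
      unfolding inf_conv_def by (intro Inf_greatest) (auto simp: delta_def S)
    show "inf_conv n (delta S1) (delta S2) x \<le> delta S x"
    proof (cases "x \<in> S")
      case True
      then obtain y z where yz: "y \<in> S1" "z \<in> S2" "x = y + z" by (auto simp: S)
      then show ?thesis
        using inf_conv_lower[of y n z "delta S1" "delta S2"] c True by (auto simp: delta_def)
    qed (simp add: delta_def)
  qed
  moreover have "S \<noteq> {}" using c by (auto simp: S)
  moreover have "S \<subseteq> carrier_vec n" using c by (auto simp: S intro!: add_carrier_vec)
  ultimately show ?thesis
    using Lnat_convex_delta[OF L(1)] Lnat_convex_delta[OF L(2)] proper_fun_delta
    unfolding L2nat_convex_def by blast
qed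

lemma int_box_nonempty:
  assumes "int_box n S"
  shows "S \<noteq> {}"
proof -
  obtain I where I: "\<forall>i<n. int_interval (I i)" and S: "S = {x \<in> carrier_vec n. \<forall>i<n. x $ i \<in> I i}"
    using assms unfolding int_box_iff by blast
  have "\<forall>i<n. \<exists>t. t \<in> I i" using I unfolding int_interval_iff by blast
  then obtain t where "\<forall>i<n. t i \<in> I i" by metis
  then have "vec n t \<in> S" by (auto simp: S)
  then show ?thesis by blast
qed

text \<open>A finite sum in \<open>ereal\<close> is \<infinity> exactly when some summand is. So the
  factors of the box are the effective domains of the univariate functions, and conversely these
  functions can be taken as the indicators of the factors.\<close>

lemma separable_convex_delta_iff:
  assumes "S \<subseteq> carrier_vec n"
  shows "separable_convex n (delta S) \<longleftrightarrow> int_box n S"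
proof
  assume "separable_convex n (delta S)"
  then obtain \<phi> where cv: "\<forall>i<n. univariate_convex (\<phi> i)"
    and d: "\<forall>x\<in>carrier_vec n. delta S x = (\<Sum>i<n. \<phi> i (x $ i))"
    by (auto simp: separable_convex_def)
  have "x \<in> S \<longleftrightarrow> (\<forall>i<n. \<phi> i (x $ i) < \<infinity>)" if "x \<in> carrier_vec n" for x
  proof -
    have "x \<in> S \<longleftrightarrow> delta S x \<noteq> \<infinity>" by (simp add: delta_def)
    also have "\<dots> \<longleftrightarrow> (\<forall>i<n. \<phi> i (x $ i) < \<infinity>)"
      using d that by (auto simp: sum_Pinfty)
    finally show ?thesis .
  qed
  then have "S = {x \<in> carrier_vec n. \<forall>i<n. x $ i \<in> {t. \<phi> i t < \<infinity>}}"
    using assms by auto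
  moreover have "\<forall>i<n. int_interval {t. \<phi> i t < \<infinity>}"
    using cv by (simp add: univariate_convex_def)
  ultimately show "int_box n S"
    unfolding int_box_iff by (intro exI[of _ "\<lambda>i. {t. \<phi> i t < \<infinity>}"] conjI)
next
  assume "int_box n S"
  then obtain I where I: "\<forall>i<n. int_interval (I i)"
    and S: "S = {x \<in> carrier_vec n. \<forall>i<n. x $ i \<in> I i}"
    unfolding int_box_iff by blast
  define \<phi> where "\<phi> i t = (if t \<in> I i then 0 else \<infinity> :: ereal)" for i :: nat and t
  have "univariate_convex (\<phi> i)" if "i < n" for i
  proof -
    have "{t. \<phi> i t < \<infinity>} = I i" by (auto simp: \<phi>_def)
    moreover have "2 * \<phi> i t \<le> \<phi> i (t - 1) + \<phi> i (t + 1)" for t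
    proof -
      have "t - 1 \<le> t \<and> t \<le> t + 1" by simp
      then have "t \<in> I i" if "t - 1 \<in> I i" "t + 1 \<in> I i"
        using I \<open>i < n\<close> that unfolding int_interval_iff by blast
      then show ?thesis by (auto simp: \<phi>_def)
    qed
    moreover have "\<phi> i t \<noteq> -\<infinity>" for t by (simp add: \<phi>_def)
    ultimately show ?thesis
      using I that by (simp add: univariate_convex_def)
  qed
  moreover have "delta S x = (\<Sum>i<n. \<phi> i (x $ i))" if "x \<in> carrier_vec n" for x
  proof (cases "x \<in> S")
    case True
    then show ?thesis by (simp add: delta_def \<phi>_def S)
  next
    case False
    then have "(\<Sum>i<n. \<phi> i (x $ i)) = \<infinity>"
      using that unfolding sum_Pinfty by (auto simp: S \<phi>_def)
    then show ?thesis using False by (simp add: delta_def)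
  qed
  ultimately show "separable_convex n (delta S)" unfolding separable_convex_def by blast
qed

section \<open>The two equivalences\<close>

lemma separable_convex_iff:
  assumes "n \<ge> 1" "proper_fun n f"
  shows "separable_convex n f \<longleftrightarrow> multimodular n f \<and> L2nat_convex n f"
  using assms modular_separable[OF assms(1)] multimodular_L2nat_modular
    separable_convex_multimodular separable_convex_Lnat_convex Lnat_convex_imp_L2nat_convex
  by blast

text \<open>Decomposing \<open>delta S\<close> as an infimal convolution would yield functions
  rather than sets. Instead the box itself is shown to be L-natural-convex, by reading membership of
  the midpoints off the finiteness of \<open>delta S\<close>, and the origin is added as second
  summand.\<close>

lemma int_box_L2nat_convex_set:
  assumes box: "int_box n S"
  shows "L2nat_convex_set n S"
proof -
  have S: "S \<noteq> {}" "S \<subseteq> carrier_vec n"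
    using int_box_nonempty[OF box] box by (auto simp: int_box_def)
  have L: "Lnat_convex n (delta S)"
    using box S by (intro separable_convex_Lnat_convex proper_fun_delta)
      (simp_all add: separable_convex_delta_iff)
  have "mid_up x y \<in> S \<and> mid_down x y \<in> S" if "x \<in> S" "y \<in> S" for x y
  proof -
    have "x \<in> carrier_vec n" "y \<in> carrier_vec n" using that S by auto
    from Lnat_convexD[OF L this] that show ?thesis
      by (auto simp: delta_def split: if_splits)
  qed
  then have "Lnat_convex_set n S" using S by (auto simp: Lnat_convex_set_def)
  moreover have "S = {y + z |y z. y \<in> S \<and> z \<in> {0\<^sub>v n}}"
  proof -
    have "y + 0\<^sub>v n = y" if "y \<in> S" for y using S that by auto
    then show ?thesis by force
  qed
  ultimately show ?thesis
    using Lnat_convex_set_zero unfolding L2nat_convex_set_def by blast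
qed

theorem theorem5p9:
  fixes n :: nat
  assumes "n \<ge> 1"
  shows "(\<forall>S :: int vec set. S \<subseteq> carrier_vec n \<longrightarrow>
            (int_box n S \<longleftrightarrow> multimodular_set n S \<and> L2nat_convex_set n S)) \<and>
         (\<forall>f :: int vec \<Rightarrow> ereal. proper_fun n f \<longrightarrow>
            (separable_convex n f \<longleftrightarrow> multimodular n f \<and> L2nat_convex n f))"
proof (intro conjI allI impI)
  fix S :: "int vec set"
  assume S: "S \<subseteq> carrier_vec n"
  show "int_box n S \<longleftrightarrow> multimodular_set n S \<and> L2nat_convex_set n S"
  proof
    assume box: "int_box n S"
    have "multimodular n (delta S)"
      using box S int_box_nonempty[OF box]
      by (intro separable_convex_multimodular proper_fun_delta)
        (simp_all add: separable_convex_delta_iff)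
    then show "multimodular_set n S \<and> L2nat_convex_set n S"
      using S int_box_nonempty[OF box] int_box_L2nat_convex_set[OF box]
      by (simp add: multimodular_set_def)
  next
    assume "multimodular_set n S \<and> L2nat_convex_set n S"
    then have "separable_convex n (delta S)"
      using assms separable_convex_iff[of n "delta S"]
      by (simp add: multimodular_set_def multimodular_def L2nat_convex_delta)
    then show "int_box n S" using S by (simp add: separable_convex_delta_iff)
  qed
next
  fix f :: "int vec \<Rightarrow> ereal"
  assume "proper_fun n f"
  then show "separable_convex n f \<longleftrightarrow> multimodular n f \<and> L2nat_convex n f"
    using assms by (intro separable_convex_iff)
qed

end
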